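(* Let $n$, $k$, and $s$ be positive integers with $n \geq k$ and $n > s$. Then the maximum \[ \max_{U\subset V(C_n^s),\ |U|=k} e(U) \] is attained by any set of $k$ consecutive vertices of $C_n^s$ (i.e. any set of the form $\{a, a+1, \ldots, a+k-1\}$ modulo $n$).
   Context: $C_n$ denotes the cycle graph on vertex set $\mathbb{Z}/n\mathbb{Z}$, where $i$ and $i+1$ are adjacent. For a graph $G$, its $s$-th power $G^s$ has the same vertex set, with two distinct vertices adjacent iff their distance in $G$ is at most $s$. Thus in $C_n^s$, distinct $i,j\in\mathbb{Z}/n\mathbb{Z}$ are adjacent iff $\min(|i-j|, n-|i-j|)\le s$ (representing $i,j$ in $\{1,\dots,n\}$). For a vertex subset $U$, $e(U)$ denotes the number of edges of the induced subgraph on $U$. *)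

theory Defs
  imports Main "HOL-Library.Extended_Nat"
begin

text \<open>A simple graph is a pair of a vertex set and a set of two-element edge sets.\<close>

type_synonym 'a sgraph = "'a set \<times> 'a set set"

abbreviation vertices :: "'a sgraph \<Rightarrow> 'a set" where
  "vertices G \<equiv> fst G"

abbreviation edges :: "'a sgraph \<Rightarrow> 'a set set" where
  "edges G \<equiv> snd G"

definition is_walk :: "'a sgraph \<Rightarrow> 'a list \<Rightarrow> bool" where
  "is_walk G p \<longleftrightarrow> p \<noteq> [] \<and> set p \<subseteq> vertices G \<and>
     (\<forall>i. Suc i < length p \<longrightarrow> {p ! i, p ! Suc i} \<in> edges G)"

text \<open>The length of a walk is its number of edges. Vertices that are not joined by a walk
  are at distance \<open>\<infinity>\<close>, the infimum of the empty set.\<close>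

definition graph_dist :: "'a sgraph \<Rightarrow> 'a \<Rightarrow> 'a \<Rightarrow> enat" where
  "graph_dist G u v =
     Inf {enat (length p - 1) | p. is_walk G p \<and> hd p = u \<and> last p = v}"

definition graph_power :: "'a sgraph \<Rightarrow> nat \<Rightarrow> 'a sgraph" where
  "graph_power G s =
     (vertices G,
      {{u, v} | u v. u \<in> vertices G \<and> v \<in> vertices G \<and> u \<noteq> v \<and> graph_dist G u v \<le> enat s})"

definition induced_subgraph :: "'a sgraph \<Rightarrow> 'a set \<Rightarrow> 'a sgraph" where
  "induced_subgraph G U = (U, {e \<in> edges G. e \<subseteq> U})"

definition num_edges_on :: "'a sgraph \<Rightarrow> 'a set \<Rightarrow> nat" where
  "num_edges_on G U = card (edges (induced_subgraph G U))"

text \<open>The elements of \<open>\<int>/n\<int>\<close> are represented by their residues \<open>0, \<dots>, n - 1\<close>.\<close>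

definition cycle_graph :: "nat \<Rightarrow> nat sgraph" where
  "cycle_graph n =
     ({0..<n}, {{i, j} | i j. i < n \<and> j < n \<and> i \<noteq> j \<and> j = (i + 1) mod n})"

definition consecutive :: "nat \<Rightarrow> nat \<Rightarrow> nat \<Rightarrow> nat set" where
  "consecutive n a k = (\<lambda>i. (a + i) mod n) ` {0..<k}"

end

(* Two-point symmetrization. For a reflection of the cycle and one of the two half circles it
   bounds, polarizing U moves each point of U to its mirror image in that half whenever the mirror
   image is not yet in U. Since two points of the same half are at most as far apart as one is from
   the mirror image of the other, this does not decrease the number of ordered pairs in U at
   distance at most s, which is 2 e(U) + |U|. If U differs from the interval J = {0, ..., k - 1} and
   |U| = k, choose the reflection that swaps some x in J - U with some y in U - J and the half that
   contains the midpoint of J: polarizing enlarges the intersection of U and J, so finitely many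
   steps turn U into J. *)

theory Submission
  imports Defs
begin

section \<open>Polarization with respect to an involution of a finite set\<close>

definition close_pairs :: "('a \<Rightarrow> 'a \<Rightarrow> bool) \<Rightarrow> 'a set \<Rightarrow> nat" where
  "close_pairs A U = card {(x, y). x \<in> U \<and> y \<in> U \<and> A x y}"

text \<open>\<open>H\<close> plays the closed half circle: \<open>H_cover\<close> forces the fixed
  points of \<open>\<sigma>\<close> into \<open>H\<close>, and \<open>H_inter\<close> says that only
  they have their mirror image there too. \<open>A_H\<close> is the sole trace of geometry.\<close>

locale reflection =
  fixes V :: "'a set" and \<sigma> :: "'a \<Rightarrow> 'a" and H :: "'a set" and A :: "'a \<Rightarrow> 'a \<Rightarrow> bool"
  assumes finite_V: "finite V"
    and \<sigma>_in: "x \<in> V \<Longrightarrow> \<sigma> x \<in> V"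
    and \<sigma>_\<sigma>: "x \<in> V \<Longrightarrow> \<sigma> (\<sigma> x) = x"
    and H_cover: "x \<in> V \<Longrightarrow> x \<in> H \<or> \<sigma> x \<in> H"
    and H_inter: "x \<in> V \<Longrightarrow> x \<in> H \<Longrightarrow> \<sigma> x \<in> H \<Longrightarrow> \<sigma> x = x"
    and A_\<sigma>: "x \<in> V \<Longrightarrow> y \<in> V \<Longrightarrow> A (\<sigma> x) (\<sigma> y) = A x y"
    and A_H: "x \<in> V \<Longrightarrow> y \<in> V \<Longrightarrow> x \<in> H \<Longrightarrow> y \<in> H \<Longrightarrow> A x (\<sigma> y) \<Longrightarrow> A x y"
begin

definition polarize :: "'a set \<Rightarrow> 'a set" where
  "polarize U = {x \<in> V. if x \<in> H then x \<in> U \<or> \<sigma> x \<in> U else x \<in> U \<and> \<sigma> x \<in> U}"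

lemma sum_\<sigma>: "(\<Sum>x\<in>V. g (\<sigma> x)) = (\<Sum>x\<in>V. g x)"
proof -
  have "bij_betw \<sigma> V V"
    by (rule bij_betw_byWitness[where f' = \<sigma>]) (auto simp: \<sigma>_in \<sigma>_\<sigma>)
  then show ?thesis by (rule sum.reindex_bij_betw)
qed

text \<open>Doubling allows sums to be compared orbit by orbit without choosing representatives: a
  fixed point simply contributes its value twice.\<close>

lemma sum_orbits: "2 * (\<Sum>x\<in>V. g x) = (\<Sum>x\<in>V. g x + g (\<sigma> x))" for g :: "'a \<Rightarrow> nat"
  by (simp add: sum.distrib sum_\<sigma> mult_2)

lemma sum_orbits2:
  "4 * (\<Sum>x\<in>V. \<Sum>y\<in>V. g x y) =
     (\<Sum>x\<in>V. \<Sum>y\<in>V. g x y + g x (\<sigma> y) + (g (\<sigma> x) y + g (\<sigma> x) (\<sigma> y)))"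
  for g :: "'a \<Rightarrow> 'a \<Rightarrow> nat"
proof -
  have "4 * (\<Sum>x\<in>V. \<Sum>y\<in>V. g x y) = 2 * (\<Sum>x\<in>V. 2 * (\<Sum>y\<in>V. g x y))"
    by (simp add: sum_distrib_left[symmetric])
  also have "\<dots> = (\<Sum>x\<in>V. (\<Sum>y\<in>V. g x y + g x (\<sigma> y)) + (\<Sum>y\<in>V. g (\<sigma> x) y + g (\<sigma> x) (\<sigma> y)))"
    by (simp only: sum_orbits)
  finally show ?thesis by (simp only: sum.distrib)
qed

lemma card_eq_sum: "U \<subseteq> V \<Longrightarrow> card U = (\<Sum>x\<in>V. of_bool (x \<in> U))"
  using finite_V by (simp add: Int_absorb1)

lemma close_pairs_eq_sum:
  assumes "U \<subseteq> V"
  shows "close_pairs A U = (\<Sum>x\<in>V. \<Sum>y\<in>V. of_bool (x \<in> U \<and> y \<in> U \<and> A x y))"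
proof -
  have "(\<Sum>x\<in>V. \<Sum>y\<in>V. of_bool (x \<in> U \<and> y \<in> U \<and> A x y))
      = (\<Sum>p\<in>V \<times> V. of_bool (p \<in> {(x, y). x \<in> U \<and> y \<in> U \<and> A x y}) :: nat)"
    by (simp add: sum.cartesian_product case_prod_unfold)
  also have "\<dots> = card (V \<times> V \<inter> {(x, y). x \<in> U \<and> y \<in> U \<and> A x y})"
    using finite_V by simp
  also have "V \<times> V \<inter> {(x, y). x \<in> U \<and> y \<in> U \<and> A x y} = {(x, y). x \<in> U \<and> y \<in> U \<and> A x y}"
    using assms by auto
  finally show ?thesis by (simp add: close_pairs_def)
qed

lemma polarize_subset: "polarize U \<subseteq> V"
  by (auto simp: polarize_def)

lemma polarize_H:
  assumes "x \<in> V" "x \<in> H"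
  shows "x \<in> polarize U \<longleftrightarrow> x \<in> U \<or> \<sigma> x \<in> U" "\<sigma> x \<in> polarize U \<longleftrightarrow> x \<in> U \<and> \<sigma> x \<in> U"
  using assms H_inter[of x] \<sigma>_in[of x] \<sigma>_\<sigma>[of x] by (auto simp: polarize_def)

text \<open>Reduces claims symmetric under exchanging \<open>x\<close> and \<open>\<sigma> x\<close>
  to points of \<open>H\<close>, where \<open>polarize_H\<close> describes both members of the
  orbit.\<close>

lemma orbit_cases:
  assumes "x \<in> V"
  obtains z where "z \<in> V" "z \<in> H" "x = z \<and> \<sigma> x = \<sigma> z \<or> x = \<sigma> z \<and> \<sigma> x = z"
  using assms H_cover \<sigma>_in \<sigma>_\<sigma> by metis

lemma card_polarize:
  assumes "U \<subseteq> V"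
  shows "card (polarize U) = card U"
proof -
  have "of_bool (x \<in> polarize U) + of_bool (\<sigma> x \<in> polarize U)
      = (of_bool (x \<in> U) + of_bool (\<sigma> x \<in> U) :: nat)" if x: "x \<in> V" for x
  proof -
    obtain z where z: "z \<in> V" "z \<in> H" "x = z \<and> \<sigma> x = \<sigma> z \<or> x = \<sigma> z \<and> \<sigma> x = z"
      by (rule orbit_cases[OF x])
    then show ?thesis
      using polarize_H[OF z(1,2), of U] by (cases "z \<in> U"; cases "\<sigma> z \<in> U") auto
  qed
  then have "2 * card (polarize U) = 2 * card U"
    unfolding card_eq_sum[OF polarize_subset] card_eq_sum[OF assms] sum_orbits
    by (intro sum.cong) auto
  then show ?thesis by simp
qed

text \<open>Among the four pairs between two orbits \<open>A\<close> takes only two values, one for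
  pairs on the same side and one for pairs across the axis, and the second implies the
  first.\<close>

lemma A_H':
  assumes "x \<in> V" "y \<in> V" "x \<in> H" "y \<in> H" 
  shows "A (\<sigma> x) y = A x (\<sigma> y)" "A x (\<sigma> y) \<Longrightarrow> A x y" "A (\<sigma> x) (\<sigma> y) = A x y"
  using A_\<sigma>[of x "\<sigma> y"] A_H[of x y] A_\<sigma>[of x y] \<sigma>_in \<sigma>_\<sigma> assms by auto

text \<open>Polarization preserves the number of pairs between two orbits and only
  exchanges pairs on opposite sides of the axis for pairs on the same side, which are close
  whenever the former are.\<close>

lemma close_pairs_polarize:
  assumes "U \<subseteq> V"
  shows "close_pairs A U \<le> close_pairs A (polarize U)"
proof -
  define f where "f W x y = (of_bool (x \<in> W \<and> y \<in> W \<and> A x y) :: nat)" for W x y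
  define T where "T W x y = f W x y + f W x (\<sigma> y) + (f W (\<sigma> x) y + f W (\<sigma> x) (\<sigma> y))" for W x y
  have TH: "T U x y \<le> T (polarize U) x y" if "x \<in> V" "y \<in> V" "x \<in> H" "y \<in> H" for x y
    unfolding T_def f_def A_H'(1,3)[OF that] polarize_H[OF that(1,3)] polarize_H[OF that(2,4)]
    using A_H'(2)[OF that]
    by (cases "A x y"; cases "A x (\<sigma> y)"; cases "x \<in> U"; cases "y \<in> U"; cases "\<sigma> x \<in> U"; cases "\<sigma> y \<in> U")
      simp_all
  have T: "T U x y \<le> T (polarize U) x y" if x: "x \<in> V" and y: "y \<in> V" for x y
  proof -
    obtain z where z: "z \<in> V" "z \<in> H" "x = z \<and> \<sigma> x = \<sigma> z \<or> x = \<sigma> z \<and> \<sigma> x = z"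
      by (rule orbit_cases[OF x])
    obtain w where w: "w \<in> V" "w \<in> H" "y = w \<and> \<sigma> y = \<sigma> w \<or> y = \<sigma> w \<and> \<sigma> y = w"
      by (rule orbit_cases[OF y])
    \<comment> \<open>\<open>T\<close> sums over all four pairs between the two orbits, so swapping
      the members of either orbit only permutes its summands.\<close>
    have "T W x y = T W z w" for W
      using z(3) w(3) by (elim disjE conjE) (simp_all only: T_def ac_simps)
    then show ?thesis using TH[OF z(1) w(1) z(2) w(2)] by simp
  qed
  have "4 * close_pairs A W = (\<Sum>x\<in>V. \<Sum>y\<in>V. T W x y)" if "W \<subseteq> V" for W
    unfolding close_pairs_eq_sum[OF that] f_def[symmetric] sum_orbits2 T_def ..
  then have "4 * close_pairs A U \<le> 4 * close_pairs A (polarize U)"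
    by (simp add: assms polarize_subset T sum_mono)
  then show ?thesis by simp
qed

text \<open>The condition on \<open>J\<close> says that in each orbit \<open>J\<close> prefers the
  side \<open>H\<close>. Moving points of \<open>U\<close> to that side therefore never loses a
  point of \<open>J\<close>, and in the orbit of \<open>x\<close> it gains one.\<close>

lemma card_polarize_Int_less:
  assumes "U \<subseteq> V" and J: "\<And>x. x \<in> J \<Longrightarrow> x \<in> V \<Longrightarrow> x \<notin> H \<Longrightarrow> \<sigma> x \<in> J"
    and x: "x \<in> V" "x \<in> J" "x \<notin> U" "\<sigma> x \<in> U" "\<sigma> x \<notin> J"
  shows "card (U \<inter> J) < card (polarize U \<inter> J)"
proof -
  define f where "f W z = (of_bool (z \<in> W \<inter> J) :: nat)" for W z
  have le: "f U z + f U (\<sigma> z) \<le> f (polarize U) z + f (polarize U) (\<sigma> z)" if z: "z \<in> V" for z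
  proof -
    obtain w where w: "w \<in> V" "w \<in> H" "z = w \<and> \<sigma> z = \<sigma> w \<or> z = \<sigma> w \<and> \<sigma> z = w"
      by (rule orbit_cases[OF z])
    \<comment> \<open>Either \<open>\<sigma> w\<close> lies outside \<open>H\<close>, and the
      condition on \<open>J\<close> applies to it, or \<open>w\<close> is a fixed point.\<close>
    have *: "\<sigma> w \<in> J \<Longrightarrow> w \<in> J"
      using J[of "\<sigma> w"] H_inter[of w] \<sigma>_in[of w] \<sigma>_\<sigma>[of w] w(1,2) by metis
    have "f U w + f U (\<sigma> w) \<le> f (polarize U) w + f (polarize U) (\<sigma> w)"
      unfolding f_def Int_iff polarize_H[OF w(1,2)] using *
      by (cases "w \<in> U"; cases "\<sigma> w \<in> U"; cases "w \<in> J"; cases "\<sigma> w \<in> J") simp_all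
    then show ?thesis using w(3) by (metis add.commute)
  qed
  have "x \<in> H" using J x by blast
  then have "f U x + f U (\<sigma> x) < f (polarize U) x + f (polarize U) (\<sigma> x)"
    unfolding f_def Int_iff polarize_H[OF x(1) \<open>x \<in> H\<close>] using x by simp
  then have "(\<Sum>x\<in>V. f U x + f U (\<sigma> x)) < (\<Sum>x\<in>V. f (polarize U) x + f (polarize U) (\<sigma> x))"
    using le x(1) finite_V by (intro sum_strict_mono_ex1) auto
  moreover have "2 * card (W \<inter> J) = (\<Sum>x\<in>V. f W x + f W (\<sigma> x))" if "W \<subseteq> V" for W
  proof -
    have "card (W \<inter> J) = (\<Sum>x\<in>V. f W x)"
      unfolding f_def using that by (intro card_eq_sum) blast
    then show ?thesis by (simp only: sum_orbits)
  qed
  ultimately have "2 * card (U \<inter> J) < 2 * card (polarize U \<inter> J)"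
    by (simp add: assms(1) polarize_subset)
  then show ?thesis by simp
qed

end

section \<open>Iterated polarization towards a fixed set\<close>

text \<open>Induction on the number of points of \<open>J\<close> missing from \<open>U\<close>:
  each polarization keeps the cardinality, does not lower \<open>close_pairs\<close>, and strictly
  enlarges the intersection with \<open>J\<close>.\<close>

lemma close_pairs_le_of_reflections:
  assumes "finite V" "J \<subseteq> V"
    and refl: "\<And>x y. x \<in> J \<Longrightarrow> y \<in> V - J \<Longrightarrow>
      \<exists>\<sigma> H. reflection V \<sigma> H A \<and> \<sigma> x = y \<and> (\<forall>z\<in>J. z \<notin> H \<longrightarrow> \<sigma> z \<in> J)"
    and "U \<subseteq> V" "card U = card J"
  shows "close_pairs A U \<le> close_pairs A J"
  using assms(4,5)
proof (induction "card J - card (U \<inter> J)" arbitrary: U rule: less_induct)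
  case less
  have fin: "finite U" "finite J"
    using assms(1,2) less.prems by (auto intro: finite_subset)
  show ?case
  proof (cases "U = J")
    case False
    then have "\<not> J \<subseteq> U" "\<not> U \<subseteq> J"
      using fin less.prems by (metis card_subset_eq)+
    then obtain x y where xy: "x \<in> J" "x \<notin> U" "y \<in> U" "y \<notin> J" by blast
    then obtain \<sigma> H where r: "reflection V \<sigma> H A" "\<sigma> x = y" "\<forall>z\<in>J. z \<notin> H \<longrightarrow> \<sigma> z \<in> J"
      using refl[of x y] less.prems by blast
    interpret reflection V \<sigma> H A by (rule r(1))
    have "card (U \<inter> J) < card (polarize U \<inter> J)"
      using less.prems xy r assms(2) by (intro card_polarize_Int_less[where x = x]) auto
    moreover have "card (polarize U \<inter> J) \<le> card J"
      using fin by (intro card_mono) auto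
    ultimately have "close_pairs A (polarize U) \<le> close_pairs A J"
      using less.prems by (intro less.hyps) (auto simp: card_polarize polarize_subset[THEN subsetD])
    then show ?thesis using close_pairs_polarize[OF less.prems(1)] by simp
  qed simp
qed

section \<open>Closeness on the cycle and its reflections\<close>

text \<open>Stated for arbitrary integer representatives, so that reflected points such as
  \<open>c - v\<close> need not be reduced modulo \<open>n\<close>. For positive \<open>n\<close>
  the smaller of the two residues is the cyclic distance.\<close>

definition cyc_close :: "nat \<Rightarrow> nat \<Rightarrow> int \<Rightarrow> int \<Rightarrow> bool" where
  "cyc_close n s u v \<longleftrightarrow> (u - v) mod int n \<le> int s \<or> (v - u) mod int n \<le> int s"

lemma cyc_close_cong:
  assumes "(u - v) mod int n = (u' - v') mod int n"
  shows "cyc_close n s u v = cyc_close n s u' v'"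
proof -
  have "(v - u) mod int n = (v' - u') mod int n"
    using mod_minus_cong[OF assms] by simp
  with assms show ?thesis by (simp add: cyc_close_def)
qed

lemma cyc_close_sym: "cyc_close n s u v = cyc_close n s v u"
  by (auto simp: cyc_close_def)

lemma cyc_closeI:
  assumes "\<bar>u - v\<bar> \<le> int s"
  shows "cyc_close n s u v"
proof (cases "u \<le> v")
  case True
  then have "(v - u) mod int n \<le> v - u" by (intro zmod_le_nonneg_dividend) simp
  with assms True show ?thesis unfolding cyc_close_def by linarith
next
  case False
  then have "(u - v) mod int n \<le> u - v" by (intro zmod_le_nonneg_dividend) simp
  with assms False show ?thesis unfolding cyc_close_def by linarith
qed

text \<open>The cyclic distance from \<open>u\<close> to \<open>c - v\<close> is the smaller of
  \<open>D\<close> and \<open>n - D\<close> with \<open>D = c - u - v\<close>. That \<open>u\<close>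
  and \<open>v\<close> lie in a window of length \<open>n / 2\<close> ending at \<open>c / 2\<close>
  says exactly that both numbers are at least the absolute value of \<open>u - v\<close>.\<close>

lemma cyc_close_reflect:
  assumes "c - int n \<le> 2 * u" "2 * u \<le> c" "c - int n \<le> 2 * v" "2 * v \<le> c"
    and "cyc_close n s u (c - v)"
  shows "cyc_close n s u v"
proof -
  define D where "D = c - u - v"
  have D: "0 \<le> D" "D \<le> int n" "\<bar>u - v\<bar> \<le> D" "\<bar>u - v\<bar> \<le> int n - D"
    using assms(1-4) unfolding D_def by linarith+
  have eqs: "u - (c - v) = - D" "(c - v) - u = D" by (simp_all add: D_def)
  then have "(- D) mod int n \<le> int s \<or> D mod int n \<le> int s"
    using assms(5) by (simp only: cyc_close_def eqs)
  \<comment> \<open>At \<open>D = 0\<close> and \<open>D = n\<close> the residues drop to 0, but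
    there the bounds in \<open>D\<close> already force \<open>u = v\<close>.\<close>
  moreover have "(- D) mod int n = (if D = 0 then 0 else int n - D)"
  proof (cases "D = 0")
    case False
    have "(- D) mod int n = (int n - D) mod int n" using mod_add_self1[of "int n" "- D"] by simp
    also have "\<dots> = int n - D" using False D by (intro mod_pos_pos_trivial) auto
    finally show ?thesis using False by simp
  qed simp
  moreover have "D mod int n = (if D = int n then 0 else D)" using D by auto
  ultimately have "\<bar>u - v\<bar> \<le> int s" using D by (auto split: if_splits)
  then show ?thesis by (rule cyc_closeI)
qed

text \<open>The reflection \<open>z \<mapsto> i + j - z\<close> has its axis through \<open>(i + j) / 2\<close>; as
  \<open>i < k \<le> j < n\<close>, the midpoint \<open>(k - 1) / 2\<close> of \<open>{0..<k}\<close> lies in the half circle that ends there.\<close>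

lemma cycle_reflection:
  fixes i j k n s :: nat
  assumes ij: "i < k" "k \<le> j" "j < n"
  defines "c \<equiv> int i + int j"
  defines "\<sigma> \<equiv> \<lambda>z::nat. nat ((c - int z) mod int n)"
  defines "H \<equiv> {z::nat. \<exists>u. u mod int n = int z mod int n \<and> c - int n \<le> 2 * u \<and> 2 * u \<le> c}"
  shows "reflection {0..<n} \<sigma> H (\<lambda>x y. cyc_close n s (int x) (int y))"
    and "\<sigma> i = j" and "\<forall>z\<in>{0..<k}. z \<notin> H \<longrightarrow> \<sigma> z \<in> {0..<k}"
proof -
  have n: "0 < int n" using ij by simp
  have int_\<sigma>: "int (\<sigma> z) = (c - int z) mod int n" for z
    using n by (simp add: \<sigma>_def)
  have \<sigma>\<sigma>: "\<sigma> (\<sigma> z) = z" if "z \<in> {0..<n}" for z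
  proof -
    have "int (\<sigma> (\<sigma> z)) = int z mod int n" 
      unfolding int_\<sigma> by (simp add: mod_diff_right_eq)
    then show ?thesis using that by simp
  qed
  have H_window: "z \<in> H" if "z \<in> {0..<n}" "c - int n \<le> 2 * u" "2 * u \<le> c" "u = int z \<or> u = int z - int n" for z u
    unfolding H_def by (intro CollectI exI[of _ u]) (use that in auto)
  have \<sigma>_eq: "\<sigma> z = nat t" if "0 \<le> t" "t < int n" "t = c - int z \<or> t = c - int z + int n \<or> t = c - int z - int n" for z t
  proof -
    have "(c - int z) mod int n = t mod int n" using that(3) by (auto simp: mod_diff_right_eq)
    then show ?thesis using that by (simp add: \<sigma>_def)
  qed
  show "\<sigma> i = j" using \<sigma>_eq[of "int j" i] ij by (simp add: c_def)
  show "\<forall>z\<in>{0..<k}. z \<notin> H \<longrightarrow> \<sigma> z \<in> {0..<k}"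
  proof (intro ballI impI)
    fix z assume z: "z \<in> {0..<k}" "z \<notin> H"
    have "\<not> (c - int n \<le> 2 * int z \<and> 2 * int z \<le> c)"
      using z ij H_window[of z "int z"] by auto
    \<comment> \<open>In the first case the image \<open>c - z - n\<close> exceeds \<open>z\<close>
      and is at most \<open>i\<close>, because \<open>j < n\<close>. In the second the image
      \<open>c - z\<close> is below \<open>z\<close>, and it is nonnegative because
      \<open>z < k \<le> j\<close>.\<close>
    then consider "2 * int z < c - int n" | "c < 2 * int z" by linarith
    then show "\<sigma> z \<in> {0..<k}"
    proof cases
      case 1
      have "\<sigma> z = nat (c - int z - int n)" using 1 z ij by (intro \<sigma>_eq) (auto simp: c_def)
      then show ?thesis using 1 ij z by (auto simp: c_def)
    next
      case 2
      have "\<sigma> z = nat (c - int z)" using 2 z ij by (intro \<sigma>_eq) (auto simp: c_def)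
      then show ?thesis using 2 ij z by (auto simp: c_def)
    qed
  qed
  show "reflection {0..<n} \<sigma> H (\<lambda>x y. cyc_close n s (int x) (int y))"
  proof
    fix x assume x: "x \<in> {0..<n}"
    show \<sigma>x: "\<sigma> x \<in> {0..<n}" using n by (simp add: \<sigma>_def nat_less_iff)
    show "\<sigma> (\<sigma> x) = x" by (rule \<sigma>\<sigma>[OF x])
    \<comment> \<open>The representative of \<open>x\<close> with \<open>2 * u\<close> in the full
      period from \<open>c - n\<close> to \<open>c + n\<close>; doubling avoids halving
      \<open>c\<close>. If \<open>u\<close> is beyond the window, then \<open>c - u\<close> falls
      into it.\<close>
    define u where "u = int x - int n * ((2 * int x - c + int n) div (2 * int n))"
    have u: "u mod int n = int x mod int n" by (simp add: u_def mod_eq_dvd_iff)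
    have "2 * u - c + int n = (2 * int x - c + int n) mod (2 * int n)"
      unfolding u_def minus_mult_div_eq_mod[symmetric] by (simp add: algebra_simps)
    then have u2: "0 \<le> 2 * u - c + int n" "2 * u - c + int n < 2 * int n" using n by simp_all
    show "x \<in> H \<or> \<sigma> x \<in> H"
    proof (cases "2 * u \<le> c")
      case True then show ?thesis using u u2 by (auto simp: H_def)
    next
      case False
      have "(c - u) mod int n = int (\<sigma> x) mod int n"
        using mod_diff_cong[OF refl u, of c] by (simp add: int_\<sigma>)
      then have "\<sigma> x \<in> H" using False u2 unfolding H_def by (intro CollectI exI[of _ "c - u"]) auto
      then show ?thesis ..
    qed
    assume "x \<in> H" "\<sigma> x \<in> H"
    then obtain u v where u: "u mod int n = int x mod int n" "c - int n \<le> 2 * u" "2 * u \<le> c"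
      and v: "v mod int n = int (\<sigma> x) mod int n" "c - int n \<le> 2 * v" "2 * v \<le> c"
      unfolding H_def by blast
    have "v mod int n = (c - u) mod int n"
      using v(1) mod_diff_cong[OF refl u(1), of c] by (simp add: int_\<sigma>)
    then have "int n dvd (c - u - v)" by (metis mod_eq_dvd_iff)
    moreover have "0 \<le> c - u - v" "c - u - v \<le> int n" using u v by linarith+
    \<comment> \<open>Either value forces \<open>u\<close> and \<open>v\<close> to the same end of
      the window, that is, onto the axis.\<close>
    ultimately have "c - u - v = 0 \<or> c - u - v = int n"
      using zdvd_imp_le[of "int n" "c - u - v"] by force
    then have "v = u" using u v by linarith
    then show "\<sigma> x = x" using u v x \<sigma>x by auto
  next
    fix x y assume "x \<in> {0..<n}" "y \<in> {0..<n}"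
    have "(int (\<sigma> x) - int (\<sigma> y)) mod int n = (int y - int x) mod int n"
      by (simp add: int_\<sigma> mod_diff_eq)
    then show "cyc_close n s (int (\<sigma> x)) (int (\<sigma> y)) = cyc_close n s (int x) (int y)"
      using cyc_close_cong cyc_close_sym by blast
  next
    fix x y assume "x \<in> H" "y \<in> H" and close: "cyc_close n s (int x) (int (\<sigma> y))"
    then obtain u v where u: "u mod int n = int x mod int n" "c - int n \<le> 2 * u" "2 * u \<le> c"
      and v: "v mod int n = int y mod int n" "c - int n \<le> 2 * v" "2 * v \<le> c"
      unfolding H_def by blast
    \<comment> \<open>Closeness depends only on differences modulo \<open>n\<close>, so it transfers
      to the representatives in the window and back.\<close>
    have "(u - (c - v)) mod int n = (int x - int (\<sigma> y)) mod int n"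
      unfolding int_\<sigma> mod_diff_right_eq by (intro mod_diff_cong u v refl)
    then have "cyc_close n s u v"
      using cyc_close_reflect[OF u(2,3) v(2,3)] close cyc_close_cong by blast
    moreover have "(u - v) mod int n = (int x - int y) mod int n"
      by (intro mod_diff_cong u v)
    ultimately show "cyc_close n s (int x) (int y)" using cyc_close_cong by blast
  qed simp
qed

section \<open>Counting close pairs by bijections and by edges\<close>

lemma close_pairs_image:
  assumes "inj_on f U" "\<And>x y. x \<in> U \<Longrightarrow> y \<in> U \<Longrightarrow> A (f x) (f y) = A x y"
  shows "close_pairs A (f ` U) = close_pairs A U"
proof -
  have "{(x, y). x \<in> f ` U \<and> y \<in> f ` U \<and> A x y} = map_prod f f ` {(x, y). x \<in> U \<and> y \<in> U \<and> A x y}"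
    using assms(2) by (auto simp: image_iff)
  moreover have "inj_on (map_prod f f) {(x, y). x \<in> U \<and> y \<in> U \<and> A x y}"
    using assms(1) by (auto simp: inj_on_def)
  ultimately show ?thesis by (simp add: close_pairs_def card_image)
qed

text \<open>The order on \<open>nat\<close> selects one orientation of each edge. The close pairs
  are these increasing pairs, their swaps, and the diagonal, which contributes
  \<open>card U\<close>.\<close>

lemma close_pairs_eq_edges:
  fixes U :: "nat set"
  assumes "finite U" "\<And>x. A x x" "\<And>x y. A x y = A y x"
  shows "close_pairs A U = 2 * card {{x, y} | x y. x \<in> U \<and> y \<in> U \<and> x \<noteq> y \<and> A x y} + card U"
proof -
  let ?L = "{(x, y). x \<in> U \<and> y \<in> U \<and> x < y \<and> A x y}"
  let ?D = "(\<lambda>x. (x, x)) ` U"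
  have fin: "finite ?L" by (rule finite_subset[of _ "U \<times> U"]) (use assms(1) in auto)
  have "{{x, y} | x y. x \<in> U \<and> y \<in> U \<and> x \<noteq> y \<and> A x y} = (\<lambda>(x, y). {x, y}) ` ?L" (is "?E = _")
  proof
    show "?E \<subseteq> (\<lambda>(x, y). {x, y}) ` ?L"
    proof
      fix e assume "e \<in> ?E"
      then obtain x y where e: "e = {x, y}" "x \<in> U" "y \<in> U" "x \<noteq> y" "A x y" by blast
      then consider "(x, y) \<in> ?L" | "(y, x) \<in> ?L" using assms(3) by fastforce
      then show "e \<in> (\<lambda>(x, y). {x, y}) ` ?L"
        using e(1) by cases (force simp: insert_commute)+
    qed
  qed auto
  moreover have "inj_on (\<lambda>(x, y). {x, y}) ?L"
    by (auto simp: inj_on_def doubleton_eq_iff)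
  ultimately have E: "card ?E = card ?L" by (simp add: card_image)
  have "{(x, y). x \<in> U \<and> y \<in> U \<and> A x y} = (?L \<union> prod.swap ` ?L) \<union> ?D"
    using assms(2,3) by (auto simp: image_iff) 
  then have "close_pairs A U = card ((?L \<union> prod.swap ` ?L) \<union> ?D)" by (simp only: close_pairs_def)
  also have "\<dots> = card (?L \<union> prod.swap ` ?L) + card ?D"
    using fin assms(1) by (intro card_Un_disjoint) auto
  also have "card (?L \<union> prod.swap ` ?L) = card ?L + card (prod.swap ` ?L)"
    using fin by (intro card_Un_disjoint) auto
  also have "card (prod.swap ` ?L) = card ?L" by (intro card_image) (simp add: inj_on_def)
  also have "card ?D = card U" by (intro card_image) (simp add: inj_on_def)
  finally show ?thesis using E by simp
qed

section \<open>Distances in the cycle and edges of its power\<close>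

lemma graph_dist_le_iff:
  "graph_dist G u v \<le> enat s \<longleftrightarrow> (\<exists>p. is_walk G p \<and> hd p = u \<and> last p = v \<and> length p \<le> Suc s)"
proof -
  \<comment> \<open>A strict bound on an infimum is witnessed by a single element, here a
    walk.\<close>
  have "graph_dist G u v \<le> enat s \<longleftrightarrow> graph_dist G u v < enat (Suc s)"
    by (cases "graph_dist G u v") auto
  also have "\<dots> \<longleftrightarrow> (\<exists>p. is_walk G p \<and> hd p = u \<and> last p = v \<and> length p \<le> Suc s)"
    unfolding graph_dist_def Inf_less_iff by force
  finally show ?thesis .
qed

text \<open>Each edge shifts the position by 1 or -1 modulo \<open>n\<close>; adding these shifts as
  integers gives \<open>t\<close>.\<close>

lemma cycle_walk_displacement:
  assumes "is_walk (cycle_graph n) p" "i < length p"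
  shows "\<exists>t. \<bar>t\<bar> \<le> int i \<and> (int (p ! i) - int (p ! 0)) mod int n = t mod int n"
  using assms(2)
proof (induction i)
  case 0
  then show ?case by (intro exI[of _ 0]) simp
next
  case (Suc i)
  then obtain t where t: "\<bar>t\<bar> \<le> int i" "(int (p ! i) - int (p ! 0)) mod int n = t mod int n" by auto
  have "{p ! i, p ! Suc i} \<in> edges (cycle_graph n)"
    using assms(1) Suc.prems by (simp add: is_walk_def)
  then have "p ! Suc i = (p ! i + 1) mod n \<or> p ! i = (p ! Suc i + 1) mod n"
    by (auto simp: cycle_graph_def doubleton_eq_iff)
  then obtain d where d: "\<bar>d\<bar> = 1" "(int (p ! Suc i) - int (p ! i)) mod int n = d mod int n"
  proof
    assume "p ! Suc i = (p ! i + 1) mod n"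
    then have "(int (p ! Suc i) - int (p ! i)) mod int n = 1 mod int n"
      by (simp add: zmod_int mod_diff_left_eq)
    then show ?thesis using that[of 1] by simp
  next
    assume "p ! i = (p ! Suc i + 1) mod n"
    then have "(int (p ! Suc i) - int (p ! i)) mod int n = (- 1) mod int n"
      by (simp add: zmod_int mod_diff_right_eq)
    then show ?thesis using that[of "- 1"] by simp
  qed
  have "(int (p ! Suc i) - int (p ! 0)) mod int n = (d + t) mod int n"
    using mod_add_cong[OF d(2) t(2)] by simp
  then show ?case using t(1) d(1) by (intro exI[of _ "d + t"]) auto
qed

lemma graph_dist_cycle_imp_close:
  assumes "graph_dist (cycle_graph n) u v \<le> enat s"
  shows "cyc_close n s (int u) (int v)"
proof -
  obtain p where p: "is_walk (cycle_graph n) p" "hd p = u" "last p = v" "length p \<le> Suc s"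
    using assms unfolding graph_dist_le_iff by blast
  then have "p \<noteq> []" by (simp add: is_walk_def)
  then obtain t where t: "\<bar>t\<bar> \<le> int (length p - 1)" "(int v - int u) mod int n = t mod int n"
    using cycle_walk_displacement[OF p(1), of "length p - 1"] p(2,3)
    by (auto simp: hd_conv_nth last_conv_nth)
  have "\<bar>t - 0\<bar> \<le> int s" using t(1) p(4) by linarith
  then have "cyc_close n s t 0" by (rule cyc_closeI)
  then have "cyc_close n s (int v) (int u)" using t(2) cyc_close_cong[of t 0 n "int v" "int u" s] by simp
  then show ?thesis using cyc_close_sym by blast
qed

text \<open>The witness is the walk that goes forward from \<open>u\<close> one residue at a time.
  With \<open>1 < n\<close> successive residues differ, as the edges of \<open>cycle_graph\<close>
  require.\<close>

lemma graph_dist_cycle_le: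
  assumes "1 < n" "u < n" "v < n" "(int v - int u) mod int n \<le> int s"
  shows "graph_dist (cycle_graph n) u v \<le> enat s"
proof -
  define t where "t = nat ((int v - int u) mod int n)"
  have t: "int t = (int v - int u) mod int n" using assms(1) by (simp add: t_def)
  define p where "p = map (\<lambda>i. (u + i) mod n) [0..<Suc t]"
  have "int ((u + t) mod n) = int v mod int n"
    by (simp add: zmod_int t mod_add_right_eq)
  then have v: "(u + t) mod n = v" using assms by simp
  have step: "x mod n \<noteq> Suc x mod n" for x
    using assms(1) by (simp add: mod_Suc)
  have "is_walk (cycle_graph n) p"
    unfolding is_walk_def
  proof (intro conjI allI impI)
    fix i assume "Suc i < length p"
    then have "p ! i = (u + i) mod n" "p ! Suc i = Suc (u + i) mod n"
      by (simp_all add: p_def del: upt_Suc)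
    then have "p ! Suc i = (p ! i + 1) mod n" "p ! i \<noteq> p ! Suc i" "p ! i < n" "p ! Suc i < n"
      using assms(1) step[of "u + i"] by (simp_all add: mod_Suc_eq)
    then show "{p ! i, p ! Suc i} \<in> edges (cycle_graph n)"
      unfolding cycle_graph_def snd_conv by blast
  qed (use assms(1) in \<open>auto simp: p_def cycle_graph_def\<close>)
  moreover have "hd p = u" using assms(2) by (simp add: p_def hd_map del: upt_Suc)
  moreover have "last p = v" using v by (simp add: p_def)
  moreover have "length p \<le> Suc s" using assms(4) t by (simp add: p_def)
  ultimately show ?thesis unfolding graph_dist_le_iff by blast
qed

lemma edges_cycle_power:
  assumes "1 < n"
  shows "edges (graph_power (cycle_graph n) s) =
    {{u, v} | u v. u < n \<and> v < n \<and> u \<noteq> v \<and> cyc_close n s (int u) (int v)}" (is "?L = ?R")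
proof
  show "?L \<subseteq> ?R"
    using graph_dist_cycle_imp_close by (fastforce simp: graph_power_def cycle_graph_def)
  show "?R \<subseteq> ?L"
  proof
    fix e assume "e \<in> ?R"
    then obtain u v where e: "e = {u, v}" "u < n" "v < n" "u \<noteq> v" "cyc_close n s (int u) (int v)"
      by blast
    \<comment> \<open>Only forward walks are available, so the second alternative of
      \<open>cyc_close\<close> is realized from \<open>u\<close> to \<open>v\<close> and the first
      from \<open>v\<close> to \<open>u\<close>; either gives the same unordered edge.\<close>
    then have "graph_dist (cycle_graph n) u v \<le> enat s \<or> graph_dist (cycle_graph n) v u \<le> enat s"
      using graph_dist_cycle_le[OF assms] by (auto simp: cyc_close_def)
    moreover have "e = {v, u}" "vertices (cycle_graph n) = {0..<n}"
      using e(1) by (auto simp: cycle_graph_def)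
    ultimately show "e \<in> ?L"
      using e(1-4) unfolding graph_power_def by auto
  qed
qed

lemma num_edges_on_cycle_power:
  assumes "1 < n" "U \<subseteq> {0..<n}"
  shows "close_pairs (\<lambda>x y. cyc_close n s (int x) (int y)) U =
    2 * num_edges_on (graph_power (cycle_graph n) s) U + card U"
proof -
  have "{e \<in> edges (graph_power (cycle_graph n) s). e \<subseteq> U}
      = {{x, y} | x y. x \<in> U \<and> y \<in> U \<and> x \<noteq> y \<and> cyc_close n s (int x) (int y)}"
    unfolding edges_cycle_power[OF assms(1)] using assms(2) by fastforce
  moreover have "finite U" using assms(2) finite_subset by blast
  ultimately show ?thesis
    by (subst close_pairs_eq_edges)
      (simp_all add: num_edges_on_def induced_subgraph_def cyc_closeI cyc_close_sym[of n s "int y" "int x" for x y])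
qed

theorem theorem1:
  fixes n k s a :: nat
  assumes "0 < n" and "0 < k" and "0 < s"
    and "k \<le> n" and "s < n"
  defines "G \<equiv> graph_power (cycle_graph n) s"
  shows "consecutive n a k \<subseteq> vertices G \<and> card (consecutive n a k) = k \<and>
    num_edges_on G (consecutive n a k) =
      Max {num_edges_on G U | U. U \<subseteq> vertices G \<and> card U = k}"
proof -
  let ?A = "\<lambda>x y. cyc_close n s (int x) (int y)"
  have n: "1 < n" using assms by simp
  have V: "vertices G = {0..<n}" by (simp add: G_def graph_power_def cycle_graph_def)
  have sub: "consecutive n a k \<subseteq> {0..<n}" using assms(1) by (auto simp: consecutive_def)
  have inj: "inj_on (\<lambda>i. (a + i) mod n) {0..<k}"
  proof (rule inj_onI)
    fix x y assume xy: "x \<in> {0..<k}" "y \<in> {0..<k}" "(a + x) mod n = (a + y) mod n"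
    then have "(int a + int x) mod int n = (int a + int y) mod int n"
      by (metis of_nat_add zmod_int)
    then have "int x mod int n = int y mod int n"
      using mod_diff_cong[OF _ refl, of "int a + int x" "int n" "int a + int y" "int a"] by simp
    then show "x = y" using xy assms(4) by simp
  qed
  then have card: "card (consecutive n a k) = k" by (simp add: consecutive_def card_image)
  \<comment> \<open>Rotation by \<open>a\<close> preserves differences modulo \<open>n\<close>,
    which reduces the comparison to the interval starting at 0.\<close>
  have rot: "close_pairs ?A (consecutive n a k) = close_pairs ?A {0..<k}"
    unfolding consecutive_def
  proof (rule close_pairs_image[OF inj])
    fix x y :: nat
    show "?A ((a + x) mod n) ((a + y) mod n) = ?A x y"
      by (rule cyc_close_cong) (simp add: zmod_int mod_diff_eq)
  qed
  have max: "close_pairs ?A U \<le> close_pairs ?A {0..<k}" if "U \<subseteq> {0..<n}" "card U = k" for U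
  proof (rule close_pairs_le_of_reflections[of "{0..<n}"])
    fix i j assume "i \<in> {0..<k}" "j \<in> {0..<n} - {0..<k}"
    then have "i < k" "k \<le> j" "j < n" by auto
    then show "\<exists>\<sigma> H. reflection {0..<n} \<sigma> H ?A \<and> \<sigma> i = j \<and> (\<forall>z\<in>{0..<k}. z \<notin> H \<longrightarrow> \<sigma> z \<in> {0..<k})"
      by (intro exI conjI) (rule cycle_reflection; assumption)+
  qed (use that assms(4) in auto)
  have le: "num_edges_on G U \<le> num_edges_on G (consecutive n a k)"
    if "U \<subseteq> {0..<n}" "card U = k" for U
  proof -
    \<comment> \<open>Both sets have \<open>k\<close> elements, so the diagonal terms agree and
      comparing close pairs amounts to comparing edges.\<close>
    have "close_pairs ?A U \<le> close_pairs ?A (consecutive n a k)"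
      unfolding rot using that by (rule max)
    then show ?thesis
      unfolding num_edges_on_cycle_power[OF n that(1)] num_edges_on_cycle_power[OF n sub] that(2) card
      by (simp add: G_def)
  qed
  have "finite {num_edges_on G U | U. U \<subseteq> vertices G \<and> card U = k}"
    unfolding V by (rule finite_subset[of _ "num_edges_on G ` Pow {0..<n}"]) auto
  then have "Max {num_edges_on G U | U. U \<subseteq> vertices G \<and> card U = k} = num_edges_on G (consecutive n a k)"
    using sub card le by (intro Max_eqI) (auto simp: V)
  then show ?thesis using sub card V by simp
qed

end
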